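(* Let $\mathcal X$ be a nonempty convex subset of a Euclidean space $E$, $F:\mathcal X\to E$ a continuous monotone vector field, and let the conic constraint $$Xx+Gg+tT+Uu\leq_{\mathbf K}a\qquad[\mathbf K\in\mathcal K]$$ in variables $t,g,x,u$ be a $\mathcal K$-representation (respectively, an almost $\mathcal K$-representation) of $(F,\mathcal X)$. Let $\mathcal Y\subset E$ be a $\mathcal K$-representable set, $$\mathcal Y=\{y\in E:\exists v: Ay+Bv\leq_{\mathbf L}b\}\qquad[\mathbf L\in\mathcal K],$$ with nonempty intersection $\mathcal Z=\mathcal Y\cap\mathcal X$, and let $\bar F$ be the restriction of $F$ to $\mathcal Z$. Then the conic constraint $$\{Xx+Gg+tT+Uu\leq_{\mathbf K}a,\ Ax+Bv\leq_{\mathbf L}b\}$$ in variables $t,g,x,u,v$ is a $\mathcal K$-representation (respectively, an almost $\mathcal K$-representation) of $(\bar F,\mathcal Z)$.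
   Context: $\mathcal K$ is a fixed family of regular cones (closed, convex, pointed, with nonempty interior) in Euclidean spaces which contains $\mathbb R_+$, is closed under finite direct products, and is closed under passing to dual cones. $a\leq_{\mathbf K}b$ means $b-a\in\mathbf K$. Finite systems of conic constraints with cones from $\mathcal K$, linear equalities and nonstrict linear inequalities are equivalent to a single conic constraint with a cone from $\mathcal K$. Let $\mathcal X$ be a nonempty convex subset of a Euclidean space $E$. A vector field $F:\mathcal X\to E$ is monotone if $\langle F(x)-F(y),x-y\rangle\geq0$ for all $x,y\in\mathcal X$. For continuous monotone $F$ put $$\mathcal F[F,\mathcal X]=\{[t;g;x]\in\mathbb R\times E\times E: x\in\mathcal X,\ t-\langle g,y\rangle\geq\langle F(y),x-y\rangle\ \forall y\in\mathcal X\}.$$ A conic constraint $Xx+Gg+tT+Uu\leq_{\mathbf K}a$, $\mathbf K\in\mathcal K$ (or an equivalent finite system), in variables $t,g,x$ and additional variables $u$, with projection $\mathcal T$ of its solution set on the space of $[t;g;x]$, is a $\mathcal K$-representation of $(F,\mathcal X)$ if (i) $\mathcal T\subset\mathcal F[F,\mathcal X]$ and $[t;g;x]\in\mathcal T$, $t'\geq t$ imply $[t';g;x]\in\mathcal T$; and (ii) $\mathcal T\supset\{[\langle F(x),x\rangle;F(x);x]:x\in\mathcal X\}$. It is an almost $\mathcal K$-representation if (i) holds and (ii') $\mathcal T\supset\{[t;F(x);x]:x\in\mathcal X,\ t>\langle F(x),x\rangle\}$. *)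

theory Defs
  imports "HOL-Analysis.Analysis" "HOL-Library.Function_Algebras"
begin

section \<open>Coordinate spaces\<close>

text \<open>
  A family of cones living in spaces of different dimensions cannot be a type-indexed family,
  so all the spaces that carry cones or additional variables are the library's coordinate
  spaces \<^term>\<open>Euclidean_space n\<close>, whose points are the \<^typ>\<open>nat \<Rightarrow> real\<close> vanishing from index
  \<open>n\<close> on.  (The case \<open>n = 0\<close>, for instance no additional variables, is included.)
  Making \<^typ>\<open>nat \<Rightarrow> real\<close> a real vector space gives access to \<^const>\<open>linear\<close>, \<^const>\<open>convex\<close>
  and \<^const>\<open>cone\<close>.
\<close>

instantiation "fun" :: (type, real_vector) real_vector
begin

definition scaleR_fun :: "real \<Rightarrow> ('a \<Rightarrow> 'b) \<Rightarrow> 'a \<Rightarrow> 'b"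
  where "scaleR_fun c f = (\<lambda>x. c *\<^sub>R f x)"

instance
  by standard (auto simp: scaleR_fun_def fun_eq_iff scaleR_add_right scaleR_add_left)

end

abbreviation coord_space :: "nat \<Rightarrow> (nat \<Rightarrow> real) set"
  where "coord_space n \<equiv> topspace (Euclidean_space n)"

definition linear_into :: "nat \<Rightarrow> ('a::real_vector \<Rightarrow> nat \<Rightarrow> real) \<Rightarrow> bool"
  where "linear_into n f \<longleftrightarrow> linear f \<and> range f \<subseteq> coord_space n"

text \<open>
  The identification of \<open>\<real>\<^sup>m \<times> \<real>\<^sup>n\<close> with \<open>\<real>\<^sup>m\<^sup>+\<^sup>n\<close> (pairing and the two projections).
\<close>

definition vec_pair :: "nat \<Rightarrow> (nat \<Rightarrow> real) \<Rightarrow> (nat \<Rightarrow> real) \<Rightarrow> nat \<Rightarrow> real"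
  where "vec_pair m x y = (\<lambda>i. if i < m then x i else y (i - m))"

definition vec_fst :: "nat \<Rightarrow> (nat \<Rightarrow> real) \<Rightarrow> nat \<Rightarrow> real"
  where "vec_fst m z = (\<lambda>i. if i < m then z i else 0)"

definition vec_snd :: "nat \<Rightarrow> (nat \<Rightarrow> real) \<Rightarrow> nat \<Rightarrow> real"
  where "vec_snd m z = (\<lambda>i. z (m + i))"


section \<open>Families of regular cones\<close>

definition regular_cone :: "nat \<Rightarrow> (nat \<Rightarrow> real) set \<Rightarrow> bool"
  where "regular_cone n K \<longleftrightarrow>
    closedin (Euclidean_space n) K \<and> cone K \<and> convex K \<and>
    (\<forall>x. x \<in> K \<and> - x \<in> K \<longrightarrow> x = 0) \<and>
    Euclidean_space n interior_of K \<noteq> {}"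

definition nonneg_ray :: "(nat \<Rightarrow> real) set"
  where "nonneg_ray = {x \<in> coord_space 1. 0 \<le> x 0}"

definition cone_prod :: "nat \<Rightarrow> (nat \<Rightarrow> real) set \<Rightarrow> (nat \<Rightarrow> real) set \<Rightarrow> (nat \<Rightarrow> real) set"
  where "cone_prod m K L = {vec_pair m x y | x y. x \<in> K \<and> y \<in> L}"

definition dual_cone :: "nat \<Rightarrow> (nat \<Rightarrow> real) set \<Rightarrow> (nat \<Rightarrow> real) set"
  where "dual_cone n K = {y \<in> coord_space n. \<forall>x\<in>K. 0 \<le> (\<Sum>i<n. y i * x i)}"

text \<open>
  \<open>\<K> n\<close> is the set of those cones of the family whose ambient space is \<open>\<real>\<^sup>n\<close>.
  Closure under binary products gives closure under finite ones.
\<close>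

definition cone_family :: "(nat \<Rightarrow> (nat \<Rightarrow> real) set set) \<Rightarrow> bool"
  where "cone_family \<K> \<longleftrightarrow>
    (\<forall>n. \<forall>K\<in>\<K> n. regular_cone n K) \<and>
    nonneg_ray \<in> \<K> 1 \<and>
    (\<forall>m n. \<forall>K\<in>\<K> m. \<forall>L\<in>\<K> n. cone_prod m K L \<in> \<K> (m + n)) \<and>
    (\<forall>n. \<forall>K\<in>\<K> n. dual_cone n K \<in> \<K> n)"

definition cone_le :: "(nat \<Rightarrow> real) \<Rightarrow> (nat \<Rightarrow> real) set \<Rightarrow> (nat \<Rightarrow> real) \<Rightarrow> bool"
    (\<open>(_ \<preceq>\<^bsub>_\<^esub> _)\<close> [51, 0, 51] 50)
  where "a \<preceq>\<^bsub>K\<^esub> b \<longleftrightarrow> b - a \<in> K"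

text \<open>
  A conic constraint with respect to \<^term>\<open>cone_prod m K L\<close> is the system of two constraints
  with respect to \<open>K\<close> and \<open>L\<close>.
\<close>

lemma cone_le_prod_iff:
  assumes "K \<subseteq> coord_space m" "a \<in> coord_space m" "c \<in> coord_space m"
  shows "vec_pair m a b \<preceq>\<^bsub>cone_prod m K L\<^esub> vec_pair m c d \<longleftrightarrow> a \<preceq>\<^bsub>K\<^esub> c \<and> b \<preceq>\<^bsub>L\<^esub> d"
proof -
  have diff: "vec_pair m c d - vec_pair m a b = vec_pair m (c - a) (d - b)"
    by (auto simp: vec_pair_def fun_eq_iff)
  have inj: "x = x' \<and> y = y'"
    if "vec_pair m x y = vec_pair m x' y'" "x \<in> coord_space m" "x' \<in> coord_space m"
    for x x' y y'
  proof -
    have eq: "(if i < m then x i else y (i - m)) = (if i < m then x' i else y' (i - m))" for i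
      using that(1) by (simp add: vec_pair_def fun_eq_iff)
    have "x i = x' i" for i
      using eq[of i] that(2,3) by (cases "i < m") (auto simp: topspace_Euclidean_space)
    moreover have "y i = y' i" for i
      using eq[of "m + i"] by simp
    ultimately show ?thesis
      by (simp add: fun_eq_iff)
  qed
  have "c - a \<in> coord_space m"
    using assms by (simp add: topspace_Euclidean_space)
  then show ?thesis
    unfolding cone_le_def diff cone_prod_def using assms(1) inj by blast
qed

lemma bij_betw_vec_pair:
  "bij_betw (\<lambda>(x, y). vec_pair m x y) (coord_space m \<times> coord_space n) (coord_space (m + n))"
proof (rule bij_betw_byWitness[where f' = "\<lambda>z. (vec_fst m z, vec_snd m z)"])
qed (auto simp: topspace_Euclidean_space vec_pair_def vec_fst_def vec_snd_def fun_eq_iff)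


section \<open>Monotone vector fields and their representations\<close>

definition monotone_field :: "'e::euclidean_space set \<Rightarrow> ('e \<Rightarrow> 'e) \<Rightarrow> bool"
  where "monotone_field \<X> F \<longleftrightarrow> (\<forall>x\<in>\<X>. \<forall>y\<in>\<X>. 0 \<le> (F x - F y) \<bullet> (x - y))"

definition field_set :: "('e::euclidean_space \<Rightarrow> 'e) \<Rightarrow> 'e set \<Rightarrow> (real \<times> 'e \<times> 'e) set"
  where "field_set F \<X> = {(t, g, x). x \<in> \<X> \<and> (\<forall>y\<in>\<X>. F y \<bullet> (x - y) \<le> t - g \<bullet> y)}"

text \<open>
  The data of a conic constraint \<open>X x + G g + t T + U u \<preceq>\<^bsub>K\<^esub> a\<close> with \<open>K\<close> a cone of the family in
  \<open>\<real>\<^sup>n\<close> and \<open>u\<close> ranging over \<open>\<real>\<^sup>p\<close>.  Only the values of \<open>U\<close> on \<open>\<real>\<^sup>p\<close> matter; every linear map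
  on \<open>\<real>\<^sup>p\<close> has a linear extension to \<^typ>\<open>nat \<Rightarrow> real\<close>.
\<close>

definition conic_data ::
  "(nat \<Rightarrow> (nat \<Rightarrow> real) set set) \<Rightarrow> nat \<Rightarrow> (nat \<Rightarrow> real) set \<Rightarrow>
   ('e::euclidean_space \<Rightarrow> nat \<Rightarrow> real) \<Rightarrow> ('e \<Rightarrow> nat \<Rightarrow> real) \<Rightarrow> (nat \<Rightarrow> real) \<Rightarrow>
   ((nat \<Rightarrow> real) \<Rightarrow> nat \<Rightarrow> real) \<Rightarrow> (nat \<Rightarrow> real) \<Rightarrow> bool"
  where "conic_data \<K> n K X G T U a \<longleftrightarrow>
    K \<in> \<K> n \<and> linear_into n X \<and> linear_into n G \<and> T \<in> coord_space n \<and>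
    linear_into n U \<and> a \<in> coord_space n"

definition conic_proj ::
  "nat \<Rightarrow> (nat \<Rightarrow> real) set \<Rightarrow>
   ('e::euclidean_space \<Rightarrow> nat \<Rightarrow> real) \<Rightarrow> ('e \<Rightarrow> nat \<Rightarrow> real) \<Rightarrow> (nat \<Rightarrow> real) \<Rightarrow>
   ((nat \<Rightarrow> real) \<Rightarrow> nat \<Rightarrow> real) \<Rightarrow> (nat \<Rightarrow> real) \<Rightarrow> (real \<times> 'e \<times> 'e) set"
  where "conic_proj p K X G T U a =
    {(t, g, x). \<exists>u\<in>coord_space p. X x + G g + t *\<^sub>R T + U u \<preceq>\<^bsub>K\<^esub> a}"

definition sound_proj :: "(real \<times> 'e \<times> 'e) set \<Rightarrow> ('e::euclidean_space \<Rightarrow> 'e) \<Rightarrow> 'e set \<Rightarrow> bool"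
  where "sound_proj \<T> F \<X> \<longleftrightarrow>
    \<T> \<subseteq> field_set F \<X> \<and> (\<forall>t g x t'. (t, g, x) \<in> \<T> \<and> t \<le> t' \<longrightarrow> (t', g, x) \<in> \<T>)"

text \<open>
  Representations are only defined for continuous monotone fields on nonempty convex sets;
  this is part of the definitions.
\<close>

definition admissible_pair :: "('e::euclidean_space \<Rightarrow> 'e) \<Rightarrow> 'e set \<Rightarrow> bool"
  where "admissible_pair F \<X> \<longleftrightarrow>
    \<X> \<noteq> {} \<and> convex \<X> \<and> continuous_on \<X> F \<and> monotone_field \<X> F"

definition K_representation ::
  "(nat \<Rightarrow> (nat \<Rightarrow> real) set set) \<Rightarrow> nat \<Rightarrow> nat \<Rightarrow> (nat \<Rightarrow> real) set \<Rightarrow>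
   ('e::euclidean_space \<Rightarrow> nat \<Rightarrow> real) \<Rightarrow> ('e \<Rightarrow> nat \<Rightarrow> real) \<Rightarrow> (nat \<Rightarrow> real) \<Rightarrow>
   ((nat \<Rightarrow> real) \<Rightarrow> nat \<Rightarrow> real) \<Rightarrow> (nat \<Rightarrow> real) \<Rightarrow> ('e \<Rightarrow> 'e) \<Rightarrow> 'e set \<Rightarrow> bool"
  where "K_representation \<K> n p K X G T U a F \<X> \<longleftrightarrow>
    admissible_pair F \<X> \<and> conic_data \<K> n K X G T U a \<and>
    sound_proj (conic_proj p K X G T U a) F \<X> \<and>
    {(F x \<bullet> x, F x, x) | x. x \<in> \<X>} \<subseteq> conic_proj p K X G T U a"

definition almost_K_representation ::
  "(nat \<Rightarrow> (nat \<Rightarrow> real) set set) \<Rightarrow> nat \<Rightarrow> nat \<Rightarrow> (nat \<Rightarrow> real) set \<Rightarrow>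
   ('e::euclidean_space \<Rightarrow> nat \<Rightarrow> real) \<Rightarrow> ('e \<Rightarrow> nat \<Rightarrow> real) \<Rightarrow> (nat \<Rightarrow> real) \<Rightarrow>
   ((nat \<Rightarrow> real) \<Rightarrow> nat \<Rightarrow> real) \<Rightarrow> (nat \<Rightarrow> real) \<Rightarrow> ('e \<Rightarrow> 'e) \<Rightarrow> 'e set \<Rightarrow> bool"
  where "almost_K_representation \<K> n p K X G T U a F \<X> \<longleftrightarrow>
    admissible_pair F \<X> \<and> conic_data \<K> n K X G T U a \<and>
    sound_proj (conic_proj p K X G T U a) F \<X> \<and>
    {(t, F x, x) | t x. x \<in> \<X> \<and> F x \<bullet> x < t} \<subseteq> conic_proj p K X G T U a"

end

(* The additional constraint does not involve t and g, so the new system projects onto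
   {(t, g, x) in T. x in Y}.  Passing from X to the subset Z only drops inequalities
   from the definition of the field set, hence soundness is inherited, and the points required
   in the projection for Z are among those required for X. *)
theory Submission
  imports Defs
begin

lemma vec_pair_add: "vec_pair m x y + vec_pair m x' y' = vec_pair m (x + x') (y + y')"
  by (auto simp: vec_pair_def fun_eq_iff)

lemma vec_pair_scaleR: "c *\<^sub>R vec_pair m x y = vec_pair m (c *\<^sub>R x) (c *\<^sub>R y)"
  by (auto simp: vec_pair_def scaleR_fun_def fun_eq_iff)

lemma vec_pair_in_coord_space:
  "y \<in> coord_space n \<Longrightarrow> vec_pair m x y \<in> coord_space (m + n)"
  by (auto simp: vec_pair_def topspace_Euclidean_space)

lemma vec_fst_in_coord_space: "vec_fst m z \<in> coord_space m"
  by (auto simp: vec_fst_def topspace_Euclidean_space)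

lemma vec_snd_in_coord_space: "z \<in> coord_space (m + n) \<Longrightarrow> vec_snd m z \<in> coord_space n"
  by (auto simp: vec_snd_def topspace_Euclidean_space)

text \<open>\<open>vec_pair m\<close> cuts off the entries of \<open>x\<close> from index
  \<open>m\<close> on, so \<open>x\<close> is recovered only if it vanishes there. The entries of
  \<open>y\<close> are merely shifted, so the second projection needs no such condition.\<close>

lemma vec_fst_vec_pair: "x \<in> coord_space m \<Longrightarrow> vec_fst m (vec_pair m x y) = x"
  by (auto simp: vec_fst_def vec_pair_def topspace_Euclidean_space fun_eq_iff)

lemma vec_snd_vec_pair: "vec_snd m (vec_pair m x y) = y"
  by (auto simp: vec_snd_def vec_pair_def)

lemma linear_vec_fst: "linear (vec_fst m)"
  by (rule linearI) (auto simp: vec_fst_def scaleR_fun_def fun_eq_iff)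

lemma linear_vec_snd: "linear (vec_snd m)"
  by (rule linearI) (auto simp: vec_snd_def scaleR_fun_def fun_eq_iff)

lemma zero_in_coord_space: "0 \<in> coord_space n"
  by (simp add: topspace_Euclidean_space)

lemma add_in_coord_space:
  "x \<in> coord_space n \<Longrightarrow> y \<in> coord_space n \<Longrightarrow> x + y \<in> coord_space n"
  by (simp add: topspace_Euclidean_space)

lemma scaleR_in_coord_space: "x \<in> coord_space n \<Longrightarrow> c *\<^sub>R x \<in> coord_space n"
  by (simp add: topspace_Euclidean_space scaleR_fun_def)

lemma linear_intoD:
  assumes "linear_into n f"
  shows "linear f" "f x \<in> coord_space n"
  using assms unfolding linear_into_def by blast+

lemma linear_into_zero: "linear_into n (\<lambda>_. 0)"
  by (auto simp: linear_into_def topspace_Euclidean_space intro: linearI)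

lemma linear_into_vec_pair:
  assumes "linear_into m f" "linear_into n g"
  shows "linear_into (m + n) (\<lambda>x. vec_pair m (f x) (g x))"
proof -
  note f = linear_intoD(1)[OF assms(1)] and g = linear_intoD(1)[OF assms(2)]
  have "linear (\<lambda>x. vec_pair m (f x) (g x))"
    by (rule linearI)
      (simp_all only: vec_pair_add vec_pair_scaleR linear_add[OF f] linear_add[OF g]
        linear_scale[OF f] linear_scale[OF g])
  then show ?thesis
    using vec_pair_in_coord_space[OF linear_intoD(2)[OF assms(2)]]
    unfolding linear_into_def by blast
qed

text \<open>Turns \<open>U\<close> and \<open>B\<close> into maps of one joint additional variable
  by composing them with the projections onto its two halves.\<close>

lemma linear_into_compose:
  assumes "linear_into n f" "linear h"
  shows "linear_into n (\<lambda>x. f (h x))"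
  using linear_compose[OF assms(2) linear_intoD(1)[OF assms(1)]] linear_intoD(2)[OF assms(1)]
  unfolding linear_into_def comp_def by blast

lemma cone_family_subset:
  assumes "cone_family \<K>" "K \<in> \<K> n"
  shows "K \<subseteq> coord_space n"
  using assms unfolding cone_family_def regular_cone_def by (meson closedin_subset)

lemma cone_family_convex:
  assumes "cone_family \<K>" "K \<in> \<K> n"
  shows "convex K"
  using assms unfolding cone_family_def regular_cone_def by blast

text \<open>The slack \<open>b - (A y + B v)\<close> is affine in \<open>y\<close> and
  \<open>v\<close> jointly, so the slack of a convex combination is the same combination of slacks
  and stays in \<open>L\<close>. Admissibility of the restricted field needs this convexity.\<close>

lemma convex_conic_representable:
  assumes "convex L" "linear A" "linear B"
  shows "convex {y. \<exists>v\<in>coord_space q. A y + B v \<preceq>\<^bsub>L\<^esub> b}"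
proof (rule convexI)
  fix x y and c d :: real
  assume "x \<in> {y. \<exists>v\<in>coord_space q. A y + B v \<preceq>\<^bsub>L\<^esub> b}"
    and "y \<in> {y. \<exists>v\<in>coord_space q. A y + B v \<preceq>\<^bsub>L\<^esub> b}"
    and cd: "0 \<le> c" "0 \<le> d" "c + d = 1"
  then obtain v w where v: "v \<in> coord_space q" "b - (A x + B v) \<in> L"
    and w: "w \<in> coord_space q" "b - (A y + B w) \<in> L"
    unfolding cone_le_def by blast
  have "c *\<^sub>R (b - (A x + B v)) + d *\<^sub>R (b - (A y + B w)) \<in> L"
    using convexD[OF assms(1) v(2) w(2) cd] .
  \<comment> \<open>Keeping the factor \<open>c + d\<close> on \<open>b\<close> makes this an
    identity of pure linearity; \<open>c + d = 1\<close> enters only in the next step.\<close>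
  also have "c *\<^sub>R (b - (A x + B v)) + d *\<^sub>R (b - (A y + B w))
      = (c + d) *\<^sub>R b - (A (c *\<^sub>R x + d *\<^sub>R y) + B (c *\<^sub>R v + d *\<^sub>R w))"
    by (simp only: linear_add[OF assms(2)] linear_add[OF assms(3)] linear_scale[OF assms(2)]
        linear_scale[OF assms(3)]) (simp add: algebra_simps)
  finally have "A (c *\<^sub>R x + d *\<^sub>R y) + B (c *\<^sub>R v + d *\<^sub>R w) \<preceq>\<^bsub>L\<^esub> b"
    by (simp only: cd(3) cone_le_def scaleR_one)
  moreover have "c *\<^sub>R v + d *\<^sub>R w \<in> coord_space q"
    using v w by (intro add_in_coord_space scaleR_in_coord_space)
  ultimately show "c *\<^sub>R x + d *\<^sub>R y \<in> {y. \<exists>v\<in>coord_space q. A y + B v \<preceq>\<^bsub>L\<^esub> b}"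
    by blast
qed

text \<open>Two splittings occur: constraint values are stacked at index \<open>n\<close>, whereas
  the additional variable \<open>w\<close> is cut at index \<open>p\<close> into \<open>u\<close>
  and \<open>v\<close>. The joint cone belongs to the family by closure under products.\<close>

lemma conic_data_join:
  assumes "cone_family \<K>" "conic_data \<K> n K X G T U a"
    and "L \<in> \<K> m" "linear_into m A" "linear_into m B" "b \<in> coord_space m"
  shows "conic_data \<K> (n + m) (cone_prod n K L)
           (\<lambda>x. vec_pair n (X x) (A x)) (\<lambda>g. vec_pair n (G g) 0) (vec_pair n T 0)
           (\<lambda>w. vec_pair n (U (vec_fst p w)) (B (vec_snd p w))) (vec_pair n a b)"
proof -
  have "cone_prod n K L \<in> \<K> (n + m)"
    using assms(1-3) unfolding cone_family_def conic_data_def by blast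
  moreover have "linear_into n X" "linear_into n G" "linear_into n U"
    using assms(2) by (simp_all only: conic_data_def)
  ultimately show ?thesis
    unfolding conic_data_def
    by (intro conjI linear_into_vec_pair vec_pair_in_coord_space zero_in_coord_space assms(4,6)
        linear_into_zero linear_into_compose[OF _ linear_vec_fst]
        linear_into_compose[OF assms(5) linear_vec_snd])
qed

text \<open>For fixed \<open>t\<close>, \<open>g\<close>, \<open>x\<close> the product cone
  separates the constraints into one on \<open>u\<close> and one on \<open>v\<close>, so a joint
  \<open>w\<close> exists iff \<open>u\<close> and \<open>v\<close> exist independently.\<close>

lemma conic_proj_join:
  assumes "K \<subseteq> coord_space n" "linear_into n X" "linear_into n G" "T \<in> coord_space n"
    and "linear_into n U" "a \<in> coord_space n"
  shows "conic_proj (p + q) (cone_prod n K L)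
           (\<lambda>x. vec_pair n (X x) (A x)) (\<lambda>g. vec_pair n (G g) 0) (vec_pair n T 0)
           (\<lambda>w. vec_pair n (U (vec_fst p w)) (B (vec_snd p w))) (vec_pair n a b)
         = {(t, g, x). (t, g, x) \<in> conic_proj p K X G T U a \<and>
              (\<exists>v\<in>coord_space q. A x + B v \<preceq>\<^bsub>L\<^esub> b)}"
    (is "?P = ?Q")
proof -
  have split: "vec_pair n (X x) (A x) + vec_pair n (G g) 0 + t *\<^sub>R vec_pair n T 0
        + vec_pair n (U u) (B v) \<preceq>\<^bsub>cone_prod n K L\<^esub> vec_pair n a b
      \<longleftrightarrow> X x + G g + t *\<^sub>R T + U u \<preceq>\<^bsub>K\<^esub> a \<and> A x + B v \<preceq>\<^bsub>L\<^esub> b" for t g x u v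
  proof -
    \<comment> \<open>\<open>cone_le_prod_iff\<close> separates the blocks only if the upper one
      vanishes from index \<open>n\<close> on, since \<open>vec_pair n\<close> would otherwise
      truncate it.\<close>
    have "X x + G g + t *\<^sub>R T + U u \<in> coord_space n"
      by (intro add_in_coord_space scaleR_in_coord_space assms(4)
          linear_intoD(2)[OF assms(2)] linear_intoD(2)[OF assms(3)] linear_intoD(2)[OF assms(5)])
    from cone_le_prod_iff[OF assms(1) this assms(6), of "A x + B v" L b]
    show ?thesis
      by (simp only: vec_pair_add vec_pair_scaleR scaleR_zero_right add_0_right)
  qed
  have "(t, g, x) \<in> ?P \<longleftrightarrow> (t, g, x) \<in> ?Q" for t g x
  proof
    assume "(t, g, x) \<in> ?P"
    then show "(t, g, x) \<in> ?Q"
      unfolding conic_proj_def split mem_Collect_eq prod.case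
      \<comment> \<open>The two halves of \<open>w\<close> are the witnesses for \<open>u\<close>
        and \<open>v\<close>.\<close>
      using vec_fst_in_coord_space vec_snd_in_coord_space by blast
  next
    assume "(t, g, x) \<in> ?Q"
    then obtain u v where uv: "u \<in> coord_space p" "v \<in> coord_space q"
      "X x + G g + t *\<^sub>R T + U u \<preceq>\<^bsub>K\<^esub> a" "A x + B v \<preceq>\<^bsub>L\<^esub> b"
      unfolding conic_proj_def by blast
    have "vec_pair p u v \<in> coord_space (p + q)"
      using uv(2) by (rule vec_pair_in_coord_space)
    then show "(t, g, x) \<in> ?P"
      unfolding conic_proj_def split mem_Collect_eq prod.case
      using uv by (intro bexI[of _ "vec_pair p u v"])
        (simp_all only: vec_fst_vec_pair vec_snd_vec_pair simp_thms)
  qed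
  then show ?thesis
    by auto
qed

text \<open>\<open>restrict F\<close> is \<open>undefined\<close> off the smaller set, but
  continuity on a set and monotonicity only see values on it, where it agrees with
  \<open>F\<close>.\<close>

lemma admissible_pair_restrict:
  assumes "admissible_pair F \<X>" "\<Z> \<subseteq> \<X>" "\<Z> \<noteq> {}" "convex \<Z>"
  shows "admissible_pair (restrict F \<Z>) \<Z>"
proof -
  have "continuous_on \<Z> F"
    using assms continuous_on_subset unfolding admissible_pair_def by blast
  then have "continuous_on \<Z> (restrict F \<Z>)"
    by (rule continuous_on_eq) simp
  then show ?thesis
    using assms unfolding admissible_pair_def monotone_field_def by auto
qed

text \<open>That \<open>x\<close> lies in \<open>\<X>\<close> comes from the soundness of
  \<open>\<T>\<close>, so adding \<open>x \<in> \<Y>\<close> places it in the intersection. The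
  added condition does not involve \<open>t\<close>, hence upward closedness in \<open>t\<close>
  survives.\<close>

lemma sound_proj_restrict:
  assumes "sound_proj \<T> F \<X>"
  shows "sound_proj {(t, g, x). (t, g, x) \<in> \<T> \<and> x \<in> \<Y>} (restrict F (\<Y> \<inter> \<X>)) (\<Y> \<inter> \<X>)"
  using assms unfolding sound_proj_def field_set_def by auto

theorem mainTheorem15:
  fixes \<K> :: "nat \<Rightarrow> (nat \<Rightarrow> real) set set"
    and F :: "'e::euclidean_space \<Rightarrow> 'e" and \<X> \<Y> \<Z> :: "'e set"
    and n p m q :: nat
    and K L :: "(nat \<Rightarrow> real) set"
    and X G A :: "'e \<Rightarrow> nat \<Rightarrow> real"
    and U B :: "(nat \<Rightarrow> real) \<Rightarrow> nat \<Rightarrow> real"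
    and T a b :: "nat \<Rightarrow> real"
  assumes family: "cone_family \<K>"
    and field: "\<X> \<noteq> {}" "convex \<X>" "continuous_on \<X> F" "monotone_field \<X> F"
    and Y_data: "L \<in> \<K> m" "linear_into m A" "linear_into m B" "b \<in> coord_space m"
    and Y_def: "\<Y> = {y. \<exists>v\<in>coord_space q. A y + B v \<preceq>\<^bsub>L\<^esub> b}"
    and Z_def: "\<Z> = \<Y> \<inter> \<X>"
    and Z_nonempty: "\<Z> \<noteq> {}"
  shows "(K_representation \<K> n p K X G T U a F \<X> \<longrightarrow>
           K_representation \<K> (n + m) (p + q) (cone_prod n K L)
             (\<lambda>x. vec_pair n (X x) (A x)) (\<lambda>g. vec_pair n (G g) 0) (vec_pair n T 0)
             (\<lambda>w. vec_pair n (U (vec_fst p w)) (B (vec_snd p w))) (vec_pair n a b)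
             (restrict F \<Z>) \<Z>) \<and>
         (almost_K_representation \<K> n p K X G T U a F \<X> \<longrightarrow>
           almost_K_representation \<K> (n + m) (p + q) (cone_prod n K L)
             (\<lambda>x. vec_pair n (X x) (A x)) (\<lambda>g. vec_pair n (G g) 0) (vec_pair n T 0)
             (\<lambda>w. vec_pair n (U (vec_fst p w)) (B (vec_snd p w))) (vec_pair n a b)
             (restrict F \<Z>) \<Z>)"
proof -
  let ?P = "conic_proj p K X G T U a"
  let ?P' = "conic_proj (p + q) (cone_prod n K L)
      (\<lambda>x. vec_pair n (X x) (A x)) (\<lambda>g. vec_pair n (G g) 0) (vec_pair n T 0)
      (\<lambda>w. vec_pair n (U (vec_fst p w)) (B (vec_snd p w))) (vec_pair n a b)"
  have "convex \<Z>"
    unfolding Z_def Y_def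
    using convex_conic_representable[OF cone_family_convex[OF family Y_data(1)]
        linear_intoD(1)[OF Y_data(2)] linear_intoD(1)[OF Y_data(3)]] field(2)
    by (rule convex_Int)
  moreover have "admissible_pair F \<X>"
    using field by (simp add: admissible_pair_def)
  ultimately have adm: "admissible_pair (restrict F \<Z>) \<Z>"
    using admissible_pair_restrict Z_def Z_nonempty by blast
  \<comment> \<open>By \<open>Y_def\<close>, the solvability of the second constraint in
    \<open>v\<close> is exactly membership in \<open>\<Y>\<close>.\<close>
  have proj: "?P' = {(t, g, x). (t, g, x) \<in> ?P \<and> x \<in> \<Y>}" if "conic_data \<K> n K X G T U a"
    using conic_proj_join[OF cone_family_subset[OF family]] that
    unfolding conic_data_def Y_def by blast
  have sound: "sound_proj ?P' (restrict F \<Z>) \<Z>"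
    if "conic_data \<K> n K X G T U a" "sound_proj ?P F \<X>"
    using sound_proj_restrict[OF that(2)] unfolding proj[OF that(1)] Z_def .
  \<comment> \<open>Here and in \<open>almost\<close>, \<open>restrict F \<Z>\<close> equals
    \<open>F\<close> on \<open>\<Z>\<close>, so the hypothesis for \<open>\<X>\<close> puts the
    point in \<open>?P\<close>, and \<open>x \<in> \<Y>\<close> holds by
    \<open>Z_def\<close>.\<close>
  have exact: "{(restrict F \<Z> x \<bullet> x, restrict F \<Z> x, x) | x. x \<in> \<Z>} \<subseteq> ?P'"
    if "conic_data \<K> n K X G T U a" "{(F x \<bullet> x, F x, x) | x. x \<in> \<X>} \<subseteq> ?P"
    using that(2) unfolding proj[OF that(1)] Z_def by auto
  have almost: "{(t, restrict F \<Z> x, x) | t x. x \<in> \<Z> \<and> restrict F \<Z> x \<bullet> x < t} \<subseteq> ?P'"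
    if "conic_data \<K> n K X G T U a" "{(t, F x, x) | t x. x \<in> \<X> \<and> F x \<bullet> x < t} \<subseteq> ?P"
    using that(2) unfolding proj[OF that(1)] Z_def by auto
  show ?thesis
    unfolding K_representation_def almost_K_representation_def
    by (intro conjI impI adm; elim conjE)
      (rule sound exact almost conic_data_join[OF family _ Y_data]; assumption)+
qed

end
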